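(* $\mathsf{ConC}_{[0,1]}\,|_W\,\mathsf{PC}_\mathbb{R}$, i.e. neither $\mathsf{ConC}_{[0,1]}\le_W\mathsf{PC}_\mathbb{R}$ nor $\mathsf{PC}_\mathbb{R}\le_W\mathsf{ConC}_{[0,1]}$. In particular also $\mathsf{ConC}_{[0,1]}\not\le_W\mathsf{PC}_{[0,1]}$.
   Context: A represented space is a pair $(X,\delta_X)$ with $\delta_X:\subseteq\mathbb{N}^\mathbb{N}\to X$ a partial surjection; $[0,1]$ and $\mathbb R$ carry their Cauchy representations. A realizer of $f:\subseteq X\rightrightarrows Y$ is a partial $F$ with $\delta_Y F(p)\in f(\delta_X(p))$ for all $p\in\mathrm{dom}(f\circ\delta_X)$. $f\le_W g$ if there are computable partial $H,K:\subseteq\mathbb{N}^\mathbb{N}\to\mathbb{N}^\mathbb{N}$ such that $p\mapsto H\langle p,GK(p)\rangle$ realizes $f$ for every realizer $G$ of $g$. $\mathcal{A}_-(X)$ denotes the closed subsets of $X$ represented by negative information (a name of $A$ enumerates rational open intervals whose union is $X\setminus A$). Closed choice $\mathsf C_X:\subseteq\mathcal A_-(X)\rightrightarrows X$, $A\mapsto A$, is defined on nonempty $A$. $\mathsf{ConC}_{[0,1]}$ is $\mathsf C_{[0,1]}$ restricted to nonempty connected closed sets, i.e., intervals $[a,b]$ with $0\le a\le b\le1$ (singletons included). $\mathsf{PC}_X$ is $\mathsf C_X$ restricted to closed $A$ with positive Lebesgue measure. *)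

theory Defs
  imports "HOL-Analysis.Analysis" "HOL-Library.Nat_Bijection"
begin

datatype recf = RZero | RSucc | RProj nat | RComp recf "recf list"
  | RPrim recf recf | RMin recf

inductive reval :: "recf \<Rightarrow> nat list \<Rightarrow> nat \<Rightarrow> bool" where
  "reval RZero xs 0"
| "reval RSucc (x # xs) (Suc x)"
| "i < length xs \<Longrightarrow> reval (RProj i) xs (xs ! i)"
| "list_all2 (\<lambda>g y. reval g xs y) gs ys \<Longrightarrow> reval f ys z \<Longrightarrow> reval (RComp f gs) xs z"
| "reval f xs z \<Longrightarrow> reval (RPrim f g) (0 # xs) z"
| "reval (RPrim f g) (n # xs) y \<Longrightarrow> reval g (y # n # xs) z
     \<Longrightarrow> reval (RPrim f g) (Suc n # xs) z"
| "reval f (n # xs) 0 \<Longrightarrow> (\<forall>m<n. \<exists>y. reval f (m # xs) y \<and> 0 < y)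
     \<Longrightarrow> reval (RMin f) xs n"

definition total_recursive :: "(nat \<Rightarrow> nat) \<Rightarrow> bool" where
  "total_recursive h \<longleftrightarrow> (\<exists>c. \<forall>x. reval c [x] (h x))"

type_synonym baire = "nat \<Rightarrow> nat"

definition prefix_code :: "baire \<Rightarrow> nat \<Rightarrow> nat" where
  "prefix_code p n = list_encode (map p [0..<n])"

text \<open>A (total HOL function) F is computable on the set D iff there is a total recursive
  word function h such that, for every p in D, the words h(p|n) are prefixes of F p and
  their lengths are unbounded. This is the standard characterisation of
  F restricted to D being the restriction of a computable partial function.\<close>
definition computable_on :: "baire set \<Rightarrow> (baire \<Rightarrow> baire) \<Rightarrow> bool" where
  "computable_on D F \<longleftrightarrow> (\<exists>h. total_recursive h \<and>
     (\<forall>p\<in>D. (\<forall>n. let w = list_decode (h (prefix_code p n))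
                     in \<forall>i<length w. w ! i = F p i)
            \<and> (\<forall>k. \<exists>n. k < length (list_decode (h (prefix_code p n))))))"

definition pairB :: "baire \<Rightarrow> baire \<Rightarrow> baire" where
  "pairB p q n = (if even n then p (n div 2) else q (n div 2))"

text \<open>A representation is given as a single-valued relation  rep p x  meaning
  "p is a name of x". A multivalued problem f :\<subseteq> X \<rightrightarrows> Y is given by its domain D
  and its value map f.\<close>

definition realizes ::
  "(baire \<Rightarrow> 'a \<Rightarrow> bool) \<Rightarrow> (baire \<Rightarrow> 'b \<Rightarrow> bool) \<Rightarrow> 'a set \<Rightarrow> ('a \<Rightarrow> 'b set)
    \<Rightarrow> (baire \<Rightarrow> baire) \<Rightarrow> bool" where
  "realizes repX repY D f G \<longleftrightarrow>
     (\<forall>p x. repX p x \<and> x \<in> D \<longrightarrow> (\<exists>y. repY (G p) y \<and> y \<in> f x))"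

definition weihrauch_le ::
  "(baire \<Rightarrow> 'a \<Rightarrow> bool) \<Rightarrow> (baire \<Rightarrow> 'b \<Rightarrow> bool) \<Rightarrow> 'a set \<Rightarrow> ('a \<Rightarrow> 'b set)
   \<Rightarrow> (baire \<Rightarrow> 'c \<Rightarrow> bool) \<Rightarrow> (baire \<Rightarrow> 'd \<Rightarrow> bool) \<Rightarrow> 'c set \<Rightarrow> ('c \<Rightarrow> 'd set)
   \<Rightarrow> bool" where
  "weihrauch_le repX repY Df f repU repV Dg g \<longleftrightarrow>
     (\<exists>H K DH DK. computable_on DH H \<and> computable_on DK K \<and>
        (\<forall>G. realizes repU repV Dg g G \<longrightarrow>
           (\<forall>p x. repX p x \<and> x \<in> Df \<longrightarrow>
              p \<in> DK \<and> (\<exists>u. repU (K p) u \<and> u \<in> Dg) \<and>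
              pairB p (G (K p)) \<in> DH \<and>
              (\<exists>y. repY (H (pairB p (G (K p)))) y \<and> y \<in> f x))))"

definition nu_rat :: "nat \<Rightarrow> real" where
  "nu_rat n = (case prod_decode n of (a, b) \<Rightarrow> real_of_int (int_decode a) / real (Suc b))"

definition cauchy_R :: "baire \<Rightarrow> real \<Rightarrow> bool" where
  "cauchy_R p x \<longleftrightarrow> (\<forall>n. \<bar>nu_rat (p n) - x\<bar> \<le> (1/2) ^ n)"

definition cauchy_I :: "baire \<Rightarrow> real \<Rightarrow> bool" where
  "cauchy_I p x \<longleftrightarrow> x \<in> {0..1} \<and> cauchy_R p x"

definition rat_interval :: "nat \<Rightarrow> real set" where
  "rat_interval n = (case prod_decode n of (a, b) \<Rightarrow> {nu_rat a <..< nu_rat b})"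

definition neg_rep :: "real set \<Rightarrow> baire \<Rightarrow> real set \<Rightarrow> bool" where
  "neg_rep X p A \<longleftrightarrow> A \<subseteq> X \<and> (\<Union>n. rat_interval (p n)) \<inter> X = X - A"

text \<open>Domains of the choice problems (the value map is the identity A \<mapsto> A).\<close>
definition ConC_I_dom :: "real set set" where
  "ConC_I_dom = {A. \<exists>a b. 0 \<le> a \<and> a \<le> b \<and> b \<le> 1 \<and> A = {a..b}}"

definition PC_dom :: "real set \<Rightarrow> real set set" where
  "PC_dom X = {A. A \<subseteq> X \<and> closed A \<and> 0 < emeasure lebesgue A}"

end

theory Submission
  imports Defs
begin

section \<open>Convergence and continuity in Baire space\<close>

text \<open>Both separations are topological: a reduction is a pair of continuous maps
  \<open>H\<close>, \<open>K\<close>, and compactness forces \<open>H\<close> to commit itself on a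
  limit instance.

  Positive choice on the line does not reduce to connected choice because the solutions of the
  latter stay in [0,1]. Names of {t..} can converge to a name of the whole line. Solutions
  \<open>y t\<close> of their \<open>K\<close>-images have dyadic names in a compact set, so a
  subsequence of these names converges to a name of a solution of the limit instance
  (\<open>accumulating_solutions\<close>). By continuity the first output of \<open>H\<close> is
  eventually constant, yet it must approximate reals \<ge> t.

  Conversely, points q of Baire space code nested intervals, and \<open>K\<close> sends each to a
  closed set of positive measure. The q whose image has measure at least 1/(N+1) within [-N,N] form
  closed sets (\<open>closed_measure_coded_set_ge\<close>) covering Baire space, so by Baire
  category one of them contains a ball. Inside the ball more than 2N(N+1) separated subintervals are
  still available; their images cannot be disjoint (\<open>measure_pigeonhole\<close>), so two share
  a solution y. Selecting the subintervals ever later makes both families of instances converge to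
  one limit, where \<open>H\<close> cannot send the shared solutions into two separated intervals.
  The argument works for any closed space X, hence for the line and for [0,1].\<close>

lemma baire_tendsto_iff:
  fixes P :: "'i \<Rightarrow> baire"
  shows "(P \<longlongrightarrow> p) F \<longleftrightarrow> (\<forall>i. \<forall>\<^sub>F t in F. P t i = p i)"
proof -
  have "(P \<longlongrightarrow> p) F \<longleftrightarrow> limitin (product_topology (\<lambda>i. euclidean) UNIV) P p F"
    by (simp add: euclidean_product_topology)
  also have "\<dots> \<longleftrightarrow> (\<forall>i. ((\<lambda>t. P t i) \<longlongrightarrow> p i) F)"
    unfolding limitin_componentwise by simp
  finally show ?thesis
    by (simp add: tendsto_discrete)
qed

lemma baire_tendsto_prefix:
  fixes P :: "'i \<Rightarrow> baire"
  assumes "(P \<longlongrightarrow> p) F"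
  shows "\<forall>\<^sub>F t in F. \<forall>i<n. P t i = p i"
  using assms eventually_ball_finite[of "{..<n}" "\<lambda>t i. P t i = p i" F]
  by (simp add: baire_tendsto_iff Ball_def)

lemma baire_tendsto_eq_below:
  fixes P :: "nat \<Rightarrow> baire"
  assumes "\<And>t i. i < t \<Longrightarrow> P t i = p i"
  shows "P \<longlonglongrightarrow> p"
  unfolding baire_tendsto_iff
proof
  fix i
  show "\<forall>\<^sub>F t in sequentially. P t i = p i"
    using eventually_gt_at_top[of i] by eventually_elim (rule assms)
qed

text \<open>Output coordinate k is determined by the finite input prefix on which \<open>h\<close>
  has already written more than k entries.\<close>

lemma computable_on_imp_continuous_on:
  assumes "computable_on D F"
  shows "continuous_on D F"
proof -
  from assms obtain h where h: "\<And>p n i. p \<in> D \<Longrightarrow> i < length (list_decode (h (prefix_code p n)))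
        \<Longrightarrow> list_decode (h (prefix_code p n)) ! i = F p i"
      "\<And>p k. p \<in> D \<Longrightarrow> \<exists>n. k < length (list_decode (h (prefix_code p n)))"
    unfolding computable_on_def Let_def by blast
  show ?thesis
    unfolding continuous_on_def baire_tendsto_iff
  proof (intro ballI allI)
    fix p k
    assume p: "p \<in> D"
    obtain n where n: "k < length (list_decode (h (prefix_code p n)))"
      using h(2) p by blast
    have "\<forall>\<^sub>F q in at p within D. \<forall>i<n. q i = p i"
      by (rule baire_tendsto_prefix) (rule tendsto_ident_at)
    moreover have "\<forall>\<^sub>F q in at p within D. q \<in> D"
      by (simp add: eventually_at_filter)
    ultimately show "\<forall>\<^sub>F q in at p within D. F q k = F p k"
    proof eventually_elim
      case (elim q)
      then have "map q [0..<n] = map p [0..<n]"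
        by auto
      then have "prefix_code q n = prefix_code p n"
        by (simp only: prefix_code_def)
      then show ?case
        using h(1)[OF p n] h(1)[of q k n] elim n by simp
    qed
  qed
qed

lemma pairB_tendsto:
  assumes "P \<longlonglongrightarrow> p" "R \<longlonglongrightarrow> r"
  shows "(\<lambda>t. pairB (P t) (R t)) \<longlonglongrightarrow> pairB p r"
  using assms by (auto simp: baire_tendsto_iff pairB_def)

section \<open>Compactness and completeness of Baire space\<close>

text \<open>By Tychonoff, a product of finite sets is compact, hence sequentially compact.\<close>

lemma baire_finite_branching_subsequence:
  fixes R :: "nat \<Rightarrow> baire"
  assumes "\<And>t i. R t i \<in> F i" and "\<And>i. finite (F i)"
  obtains s r where "strict_mono s" "(R \<circ> s) \<longlonglongrightarrow> r"
proof -
  have "compact (Pi\<^sub>E UNIV F)"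
    using assms(2) compactin_PiE[of "\<lambda>i. euclidean" UNIV F]
    by (simp add: euclidean_product_topology finite_imp_compact)
  then have "seq_compact (Pi\<^sub>E UNIV F)"
    by (rule compact_imp_seq_compact)
  moreover have "\<forall>t. R t \<in> Pi\<^sub>E UNIV F"
    using assms(1) by auto
  ultimately show ?thesis
    using that unfolding seq_compact_def by blast
qed

text \<open>A countable product of discrete spaces is completely metrizable; this makes the Baire
  category theorem available.\<close>

lemma completely_metrizable_baire: "completely_metrizable_space (euclidean :: baire topology)"
proof -
  have "discrete_topology UNIV = (euclidean :: nat topology)"
    by (simp add: discrete_topology_unique open_discrete)
  then have "completely_metrizable_space (euclidean :: nat topology)"
    using completely_metrizable_space_discrete_topology by metis
  then have "completely_metrizable_space (product_topology (\<lambda>_ :: nat. euclidean :: nat topology) UNIV)"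
    by (simp add: completely_metrizable_space_product_topology)
  then show ?thesis
    by (simp add: euclidean_product_topology)
qed

section \<open>Names of reals and of closed sets\<close>

definition rat_code :: "real \<Rightarrow> nat" where
  "rat_code x = (SOME n. nu_rat n = x)"

lemma nu_rat_rat_code [simp]:
  assumes "x \<in> \<rat>"
  shows "nu_rat (rat_code x) = x"
proof -
  obtain a b :: int where ab: "x = of_int a / of_int b" "b > 0"
    using assms by (meson Rats_cases')
  have "nu_rat (prod_encode (int_encode a, nat b - 1)) = x"
    using ab by (simp add: nu_rat_def of_nat_diff)
  then show ?thesis
    unfolding rat_code_def by (rule someI)
qed

text \<open>Entry n rounds x down to a multiple of 1/2^n. Unlike arbitrary Cauchy names, these have
  only finitely many possible n-th entries for bounded x, which gives compactness.\<close>

definition dyadic_name :: "real \<Rightarrow> baire" where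
  "dyadic_name x n = rat_code (of_int \<lfloor>x * 2 ^ n\<rfloor> / 2 ^ n)"

lemma cauchy_R_dyadic_name: "cauchy_R (dyadic_name x) x"
  unfolding cauchy_R_def
proof
  fix n
  have "of_int \<lfloor>x * 2 ^ n\<rfloor> / 2 ^ n - x = (of_int \<lfloor>x * 2 ^ n\<rfloor> - x * 2 ^ n) / 2 ^ n"
    by (simp add: diff_divide_distrib)
  moreover have "\<bar>of_int \<lfloor>x * 2 ^ n\<rfloor> - x * 2 ^ n\<bar> \<le> 1"
    by linarith
  ultimately have "\<bar>of_int \<lfloor>x * 2 ^ n\<rfloor> / 2 ^ n - x\<bar> \<le> 1 / 2 ^ n"
    by (simp add: divide_right_mono)
  then show "\<bar>nu_rat (dyadic_name x n) - x\<bar> \<le> (1 / 2) ^ n"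
    by (simp add: dyadic_name_def power_divide)
qed

lemma dyadic_name_finite_branching:
  "finite ((\<lambda>x. dyadic_name x n) ` {x. \<bar>x\<bar> \<le> B})"
proof (rule finite_surj)
  show "finite {- \<lceil>B * 2 ^ n\<rceil> - 1 .. \<lceil>B * 2 ^ n\<rceil>}"
    by simp
  show "(\<lambda>x. dyadic_name x n) ` {x. \<bar>x\<bar> \<le> B}
    \<subseteq> (\<lambda>k. rat_code (of_int k / 2 ^ n)) ` {- \<lceil>B * 2 ^ n\<rceil> - 1 .. \<lceil>B * 2 ^ n\<rceil>}"
  proof
    fix y assume "y \<in> (\<lambda>x. dyadic_name x n) ` {x. \<bar>x\<bar> \<le> B}"
    then obtain x where x: "\<bar>x\<bar> \<le> B" "y = dyadic_name x n"
      by blast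
    have "\<bar>x * 2 ^ n\<bar> \<le> B * 2 ^ n"
      using x(1) by (simp add: abs_mult mult_right_mono)
    then have "\<lfloor>x * 2 ^ n\<rfloor> \<in> {- \<lceil>B * 2 ^ n\<rceil> - 1 .. \<lceil>B * 2 ^ n\<rceil>}"
      unfolding atLeastAtMost_iff by linarith
    then show "y \<in> (\<lambda>k. rat_code (of_int k / 2 ^ n)) ` {- \<lceil>B * 2 ^ n\<rceil> - 1 .. \<lceil>B * 2 ^ n\<rceil>}"
      using x(2) by (auto simp: dyadic_name_def)
  qed
qed

text \<open>For each n the entry \<open>R t n\<close> is eventually \<open>r n\<close>, so
  \<open>y t\<close> eventually stays within 1/2^n of one fixed rational. Hence y is Cauchy and its
  limit inherits all these bounds.\<close>

lemma cauchy_R_limit: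
  assumes "R \<longlonglongrightarrow> r" and "\<And>t. cauchy_R (R t) (y t)"
  obtains z where "y \<longlonglongrightarrow> z" "cauchy_R r z"
proof -
  have close: "\<forall>\<^sub>F t in sequentially. \<bar>nu_rat (r n) - y t\<bar> \<le> (1/2) ^ n" for n
  proof -
    have "\<forall>\<^sub>F t in sequentially. R t n = r n"
      using assms(1) by (simp add: baire_tendsto_iff)
    then show ?thesis
      by eventually_elim (use assms(2) in \<open>metis cauchy_R_def\<close>)
  qed
  have "Cauchy y"
  proof (rule metric_CauchyI)
    fix e :: real assume "0 < e"
    then obtain n where n: "(1/2) ^ n < e / 2"
      using real_arch_pow_inv[of "e/2" "1/2"] by auto
    obtain T where "\<And>t. t \<ge> T \<Longrightarrow> \<bar>nu_rat (r n) - y t\<bar> \<le> (1/2) ^ n"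
      using close[of n] by (auto simp: eventually_sequentially)
    then have "\<bar>nu_rat (r n) - y t\<bar> < e / 2" if "t \<ge> T" for t
      using n that by (meson order_le_less_trans)
    then have "dist (y s) (y t) < e" if "s \<ge> T" "t \<ge> T" for s t
      using that by (smt (verit) dist_real_def field_sum_of_halves)
    then show "\<exists>T. \<forall>s\<ge>T. \<forall>t\<ge>T. dist (y s) (y t) < e"
      by blast
  qed
  then obtain z where z: "y \<longlonglongrightarrow> z"
    by (auto simp: Cauchy_convergent_iff convergent_def)
  have "\<bar>nu_rat (r n) - z\<bar> \<le> (1/2) ^ n" for n
    by (rule tendsto_upperbound[OF _ close]) (auto intro!: tendsto_intros z)
  then show ?thesis
    using that z by (simp add: cauchy_R_def)
qed

section \<open>Closed sets given by negative information\<close>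

text \<open>Turns the relation \<open>neg_rep\<close> into a function: relative to X, every p names
  exactly this set.\<close>

definition coded_set :: "real set \<Rightarrow> baire \<Rightarrow> real set" where
  "coded_set X p = X - (\<Union>n. rat_interval (p n))"

lemma neg_rep_coded_set: "neg_rep X p A \<Longrightarrow> coded_set X p = A"
  unfolding neg_rep_def coded_set_def by blast

lemma open_rat_interval [simp]: "open (rat_interval n)"
  by (simp add: rat_interval_def split: prod.split)

lemma closed_coded_set:
  assumes "closed X" shows "closed (coded_set X p)"
  unfolding coded_set_def using assms by (intro closed_Diff open_UN) auto

text \<open>An interval of p that contained z would eventually be listed by \<open>P t\<close> as
  well and, being open, would eventually contain \<open>y t\<close>.\<close>

lemma coded_set_limit:
  assumes "closed X" and "P \<longlonglongrightarrow> p" and "y \<longlonglongrightarrow> z" and y: "\<And>t. y t \<in> coded_set X (P t)"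
  shows "z \<in> coded_set X p"
proof -
  have "z \<in> X"
    using assms closed_sequentially by (metis DiffD1 coded_set_def)
  moreover have "z \<notin> rat_interval (p n)" for n
  proof
    assume "z \<in> rat_interval (p n)"
    then have "\<forall>\<^sub>F t in sequentially. y t \<in> rat_interval (p n)"
      using assms(3) topological_tendstoD open_rat_interval by blast
    moreover have "\<forall>\<^sub>F t in sequentially. P t n = p n"
      using assms(2) by (simp add: baire_tendsto_iff)
    ultimately have "\<forall>\<^sub>F t in sequentially. False"
    proof eventually_elim
      case (elim t)
      then show False
        using y[of t] unfolding coded_set_def by (metis DiffD2 UN_I UNIV_I)
    qed
    then show False
      by simp
  qed
  ultimately show ?thesis
    by (simp add: coded_set_def)
qed

text \<open>The first \<open>k\<close> entries of a name already bound the measure up to an arbitrarily small error.\<close>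

lemma closed_measure_coded_set_ge:
  assumes "closed X"
  shows "closed {p. e \<le> measure lborel (coded_set X p \<inter> {-b..b})}"
  unfolding closed_sequential_limits
proof (intro allI impI, elim conjE)
  fix P p
  assume ge: "\<forall>t. P t \<in> {p. e \<le> measure lborel (coded_set X p \<inter> {-b..b})}"
    and lim: "P \<longlonglongrightarrow> p"
  \<comment> \<open>These truncations decrease to the bounded part of the coded set, and any
    \<open>P t\<close> agreeing with p below k codes a set whose bounded part lies in
    \<open>A k\<close>.\<close>
  define A where "A k = (X - (\<Union>n<k. rat_interval (p n))) \<inter> {-b..b}" for k
  have meas: "A k \<in> sets lborel" for k
    unfolding A_def using assms by (simp add: borel_closed closed_Diff open_UN)
  have fin: "emeasure lborel B \<noteq> \<infinity>" if "B \<subseteq> {-b..b}" for B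
    using that emeasure_bounded_finite[of B] bounded_subset[of "{-b..b}" B] by auto
  have "(\<lambda>k. measure lborel (A k)) \<longlonglongrightarrow> measure lborel (\<Inter>k. A k)"
    by (rule Lim_measure_decseq) (use meas fin in \<open>auto simp: decseq_def A_def\<close>)
  moreover have "(\<Inter>k. A k) = coded_set X p \<inter> {-b..b}"
    unfolding A_def coded_set_def by auto
  moreover have "e \<le> measure lborel (A k)" for k
  proof -
    obtain t where t: "\<forall>n<k. P t n = p n"
      using baire_tendsto_prefix[OF lim, of k] eventually_happens sequentially_bot by blast
    have "e \<le> measure lborel (coded_set X (P t) \<inter> {-b..b})"
      using ge by blast
    also have "\<dots> \<le> measure lborel (A k)"
    proof (rule measure_mono_fmeasurable)
      show "coded_set X (P t) \<inter> {-b..b} \<subseteq> A k"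
        unfolding A_def coded_set_def using t by (auto, metis)
      show "coded_set X (P t) \<inter> {-b..b} \<in> sets lborel"
        using assms by (simp add: borel_closed closed_coded_set)
      show "A k \<in> fmeasurable lborel"
        using meas fin[of "A k"] by (auto simp: fmeasurable_def A_def top.not_eq_extremum)
    qed
    finally show ?thesis .
  qed
  ultimately show "p \<in> {p. e \<le> measure lborel (coded_set X p \<inter> {-b..b})}"
    by (simp add: LIMSEQ_le_const)
qed

text \<open>Otherwise, for fixed M, the part in [-M,M] has measure below 1/(N+1) for all N \<ge> M,
  so it is null, and A is a countable union of such parts. One index serves as bound and as inverse
  measure, so that a single countable family covers all instances.\<close>

lemma positive_measure_in_bounded_part:
  assumes "closed A" "0 < emeasure lebesgue A"
  obtains N :: nat where "1 / real (Suc N) \<le> measure lborel (A \<inter> {- real N..real N})"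
proof (rule ccontr)
  assume "\<not> thesis"
  then have lt: "measure lborel (A \<inter> {- real N..real N}) < 1 / real (Suc N)" for N
    using that by (meson not_le)
  let ?A = "\<lambda>N. A \<inter> {- real N..real N}"
  have meas: "?A N \<in> sets lborel" for N
    using assms(1) by (simp add: borel_closed)
  have fm: "?A N \<in> fmeasurable lborel" for N
    using meas emeasure_bounded_finite[of "?A N"] bounded_subset[of "{- real N..real N}" "?A N"]
    by (auto simp: fmeasurable_def)
  have "emeasure lborel (?A M) = 0" for M
  proof -
    have "\<forall>\<^sub>F N in sequentially. measure lborel (?A M) \<le> inverse (real (Suc N))"
      using eventually_ge_at_top[of M]
    proof eventually_elim
      case (elim N)
      have "measure lborel (?A M) \<le> measure lborel (?A N)"
        by (rule measure_mono_fmeasurable) (use elim meas fm in auto)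
      with lt[of N] show ?case
        by (simp add: inverse_eq_divide)
    qed
    then have "measure lborel (?A M) \<le> 0"
      using tendsto_lowerbound[OF LIMSEQ_inverse_real_of_nat] by force
    then show ?thesis
      using fm[of M] by (metis emeasure_eq_measure2 ennreal_0 measure_le_0_iff)
  qed
  then have "emeasure lborel (\<Union>N. ?A N) = 0"
    using meas by (intro emeasure_UN_eq_0) auto
  moreover have "(\<Union>N. ?A N) = A"
  proof -
    have "\<exists>N. x \<in> {- real N..real N}" for x
      using real_arch_simple[of "\<bar>x\<bar>"] by (auto simp: abs_le_iff minus_le_iff)
    then show ?thesis by auto
  qed
  ultimately show False
    using assms by (simp add: borel_closed)
qed

section \<open>Reductions to a choice problem\<close>

text \<open>A realizer may be altered at the single input \<open>K p\<close>. Hence \<open>H\<close>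
  must succeed on every name r of an admissible answer, not just on the values of one realizer. The
  assumption \<open>realizable\<close> supplies a realizer to alter.\<close>

lemma weihrauch_leE:
  assumes "weihrauch_le repX repY Df f repU repV Dg g"
    and realizable: "\<And>q. \<exists>r. \<forall>u. repU q u \<and> u \<in> Dg \<longrightarrow> (\<exists>v. repV r v \<and> v \<in> g u)"
  obtains H K DH DK where "computable_on DH H" "computable_on DK K"
    and "\<And>p x. repX p x \<Longrightarrow> x \<in> Df \<Longrightarrow> p \<in> DK"
    and "\<And>p x. repX p x \<Longrightarrow> x \<in> Df \<Longrightarrow> \<exists>u\<in>Dg. repU (K p) u"
    and "\<And>p x r. repX p x \<Longrightarrow> x \<in> Df
      \<Longrightarrow> (\<And>u. repU (K p) u \<Longrightarrow> u \<in> Dg \<Longrightarrow> \<exists>v. repV r v \<and> v \<in> g u)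
      \<Longrightarrow> pairB p r \<in> DH \<and> (\<exists>y. repY (H (pairB p r)) y \<and> y \<in> f x)"
proof -
  from assms(1) obtain H K DH DK where HK: "computable_on DH H" "computable_on DK K"
    and red: "\<And>G p x. realizes repU repV Dg g G \<Longrightarrow> repX p x \<Longrightarrow> x \<in> Df \<Longrightarrow>
              p \<in> DK \<and> (\<exists>u. repU (K p) u \<and> u \<in> Dg) \<and>
              pairB p (G (K p)) \<in> DH \<and>
              (\<exists>y. repY (H (pairB p (G (K p)))) y \<and> y \<in> f x)"
    unfolding weihrauch_le_def by blast
  from realizable obtain G where "\<forall>q u. repU q u \<and> u \<in> Dg \<longrightarrow> (\<exists>v. repV (G q) v \<and> v \<in> g u)"
    by metis
  then have G: "realizes repU repV Dg g G"
    by (simp add: realizes_def)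
  show thesis
  proof (rule that[OF HK])
    fix p x assume px: "repX p x" "x \<in> Df"
    show "p \<in> DK" "\<exists>u\<in>Dg. repU (K p) u"
      using red[OF G px] by auto
    fix r assume "\<And>u. repU (K p) u \<Longrightarrow> u \<in> Dg \<Longrightarrow> \<exists>v. repV r v \<and> v \<in> g u"
    then have "realizes repU repV Dg g (G(K p := r))"
      using G by (auto simp: realizes_def)
    from red[OF this px]
    show "pairB p r \<in> DH \<and> (\<exists>y. repY (H (pairB p r)) y \<and> y \<in> f x)"
      by simp
  qed
qed

text \<open>The computability of \<open>H\<close> and \<open>K\<close> only enters through their continuity.\<close>

locale reduction_to_choice =
  fixes names :: "baire \<Rightarrow> real set \<Rightarrow> bool" and X :: "real set" and \<A> :: "real set set"
    and H K :: "baire \<Rightarrow> baire" and DH DK :: "baire set"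
  assumes closed_space: "closed X"
    and continuous_H: "continuous_on DH H"
    and continuous_K: "continuous_on DK K"
    and in_DK: "names p A \<Longrightarrow> p \<in> DK"
    and instance_K: "names p A \<Longrightarrow> coded_set X (K p) \<in> \<A>"
    and in_DH: "names p A \<Longrightarrow> y \<in> coded_set X (K p) \<Longrightarrow> cauchy_R r y \<Longrightarrow> pairB p r \<in> DH"
    and solution_H: "names p A \<Longrightarrow> y \<in> coded_set X (K p) \<Longrightarrow> cauchy_R r y
      \<Longrightarrow> \<exists>z\<in>A. cauchy_R (H (pairB p r)) z"
begin

lemma K_tendsto:
  assumes "P \<longlonglongrightarrow> p" and "\<And>t. names (P t) (A t)" and "names p A'"
  shows "(\<lambda>t. K (P t)) \<longlonglongrightarrow> K p"
  using continuous_on_tendsto_compose[OF continuous_K assms(1)] in_DK[OF assms(2)] in_DK[OF assms(3)]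
  by simp

text \<open>The dyadic names of the points of a bounded set form a compact set, so bounded sequences of
  solutions of the instances \<open>K (P t)\<close> accumulate at a solution of \<open>K p\<close> along with their names.\<close>

lemma accumulating_solutions:
  assumes "P \<longlonglongrightarrow> p" and "\<And>t. names (P t) (A t)" and "names p A'"
    and y: "\<And>t. y t \<in> coded_set X (K (P t))" and bounded: "\<And>t. \<bar>y t\<bar> \<le> B"
  obtains R s w where "strict_mono s" "\<And>t. cauchy_R (R t) (y t)"
    and "\<forall>Q. Q \<longlonglongrightarrow> p \<longrightarrow> (\<forall>t. (\<exists>A. names (Q t) A) \<and> y t \<in> coded_set X (K (Q t)))
      \<longrightarrow> (\<lambda>t. H (pairB (Q (s t)) (R (s t)))) \<longlonglongrightarrow> w"
proof -
  define R where "R t = dyadic_name (y t)" for t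
  have R: "cauchy_R (R t) (y t)" for t
    by (simp add: R_def cauchy_R_dyadic_name)
  have "R t i \<in> (\<lambda>x. dyadic_name x i) ` {x. \<bar>x\<bar> \<le> B}" for t i
    using bounded by (simp add: R_def)
  then obtain s r where s: "strict_mono s" and r: "(R \<circ> s) \<longlonglongrightarrow> r"
    using baire_finite_branching_subsequence[where F = "\<lambda>i. (\<lambda>x. dyadic_name x i) ` {x. \<bar>x\<bar> \<le> B}"]
      dyadic_name_finite_branching by blast
  obtain z where z: "(y \<circ> s) \<longlonglongrightarrow> z" "cauchy_R r z"
    using cauchy_R_limit[OF r, of "y \<circ> s"] R by auto
  have "((\<lambda>t. K (P t)) \<circ> s) \<longlonglongrightarrow> K p"
    using K_tendsto[OF assms(1-3)] s by (rule LIMSEQ_subseq_LIMSEQ)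
  then have "z \<in> coded_set X (K p)"
    by (rule coded_set_limit[OF closed_space _ z(1)]) (simp add: y)
  then have pr: "pairB p r \<in> DH"
    using in_DH[OF assms(3)] z(2) by blast
  show thesis
  \<comment> \<open>The subsequence, the names and their limit r depend only on y. So any two
    sequences of instances converging to p and sharing the solutions y lead to the same limit of
    outputs.\<close>
  proof (rule that[OF s R], intro allI impI)
    fix Q assume Q: "Q \<longlonglongrightarrow> p" "\<forall>t. (\<exists>A. names (Q t) A) \<and> y t \<in> coded_set X (K (Q t))"
    have "(\<lambda>t. pairB (Q (s t)) (R (s t))) \<longlonglongrightarrow> pairB p r"
      using pairB_tendsto LIMSEQ_subseq_LIMSEQ[OF Q(1) s] r by (simp add: comp_def)
    moreover have "pairB (Q t) (R t) \<in> DH" for t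
      using Q(2) in_DH R by blast
    ultimately show "(\<lambda>t. H (pairB (Q (s t)) (R (s t)))) \<longlonglongrightarrow> H (pairB p r)"
      by (intro continuous_on_tendsto_compose[OF continuous_H _ pr]) simp_all
  qed
qed

end

text \<open>A name q determines its set, so a realizer only has to pick a point of
  \<open>coded_set X q\<close>. The assumptions on \<open>repX\<close> and \<open>repY\<close> treat
  the line and the unit interval uniformly.\<close>

lemma weihrauch_le_choice_reduction:
  assumes le: "weihrauch_le (neg_rep Y) repY \<A>' (\<lambda>A. A) (neg_rep X) repX \<A> (\<lambda>A. A)"
    and "closed X" and nonempty: "{} \<notin> \<A>"
    and repX: "\<And>r y. y \<in> X \<Longrightarrow> cauchy_R r y \<Longrightarrow> repX r y"
    and repY: "\<And>r y. repY r y \<Longrightarrow> cauchy_R r y"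
  obtains H K DH DK
  where "reduction_to_choice (\<lambda>p A. neg_rep Y p A \<and> A \<in> \<A>') X \<A> H K DH DK"
proof -
  have sub: "neg_rep X q A \<Longrightarrow> A \<subseteq> X" for q A
    by (simp add: neg_rep_def)
  have realizable: "\<exists>r. \<forall>u. neg_rep X q u \<and> u \<in> \<A> \<longrightarrow> (\<exists>v. repX r v \<and> v \<in> u)" for q
  proof (cases "coded_set X q = {}")
    case True
    then show ?thesis
      using nonempty by (metis neg_rep_coded_set)
  next
    case False
    then obtain y where "y \<in> coded_set X q"
      by blast
    then have "\<forall>u. neg_rep X q u \<and> u \<in> \<A> \<longrightarrow> repX (dyadic_name y) y \<and> y \<in> u"
      using repX[OF _ cauchy_R_dyadic_name] sub neg_rep_coded_set by blast
    then show ?thesis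
      by blast
  qed
  show thesis
  proof (rule weihrauch_leE[OF le realizable])
    fix H K DH DK
    assume HK: "computable_on DH H" "computable_on DK K"
      and DK: "\<And>p A. neg_rep Y p A \<Longrightarrow> A \<in> \<A>' \<Longrightarrow> p \<in> DK"
      and inst: "\<And>p A. neg_rep Y p A \<Longrightarrow> A \<in> \<A>' \<Longrightarrow> \<exists>u\<in>\<A>. neg_rep X (K p) u"
      and sol: "\<And>p A r. neg_rep Y p A \<Longrightarrow> A \<in> \<A>'
        \<Longrightarrow> (\<And>u. neg_rep X (K p) u \<Longrightarrow> u \<in> \<A> \<Longrightarrow> \<exists>v. repX r v \<and> v \<in> u)
        \<Longrightarrow> pairB p r \<in> DH \<and> (\<exists>y. repY (H (pairB p r)) y \<and> y \<in> A)"
    have sol': "pairB p r \<in> DH \<and> (\<exists>z\<in>A. cauchy_R (H (pairB p r)) z)"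
      if "neg_rep Y p A \<and> A \<in> \<A>'" "y \<in> coded_set X (K p)" "cauchy_R r y" for p A y r
    proof -
      have "pairB p r \<in> DH \<and> (\<exists>z. repY (H (pairB p r)) z \<and> z \<in> A)"
      proof (rule sol)
        fix u assume "neg_rep X (K p) u"
        then show "\<exists>v. repX r v \<and> v \<in> u"
          using that(2,3) repX sub neg_rep_coded_set by blast
      qed (use that in auto)
      then show ?thesis
        using repY by blast
    qed
    have "reduction_to_choice (\<lambda>p A. neg_rep Y p A \<and> A \<in> \<A>') X \<A> H K DH DK"
    proof
      show "coded_set X (K p) \<in> \<A>" if "neg_rep Y p A \<and> A \<in> \<A>'" for p A
        using inst that neg_rep_coded_set by metis
    qed (use assms(2) HK computable_on_imp_continuous_on DK sol' in blast)+
    then show thesis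
      by (rule that)
  qed
qed

section \<open>Positive choice on the line is not reducible to connected choice\<close>

definition interval_code :: "real \<Rightarrow> real \<Rightarrow> nat" where
  "interval_code a b = prod_encode (rat_code a, rat_code b)"

lemma rat_interval_interval_code [simp]:
  "a \<in> \<rat> \<Longrightarrow> b \<in> \<rat> \<Longrightarrow> rat_interval (interval_code a b) = {a<..<b}"
  by (simp add: rat_interval_def interval_code_def)

text \<open>Before it has finished excluding the half-line, the name of \<open>{t..}\<close> looks like the constant
  name of the whole line, on which \<open>H\<close> must already have committed itself to a bounded region.\<close>

lemma PC_not_le_ConC:
  "\<not> weihrauch_le (neg_rep UNIV) cauchy_R (PC_dom UNIV) (\<lambda>A. A)
                  (neg_rep {0..1}) cauchy_I ConC_I_dom (\<lambda>A. A)"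
proof
  assume le: "weihrauch_le (neg_rep UNIV) cauchy_R (PC_dom UNIV) (\<lambda>A. A)
                  (neg_rep {0..1}) cauchy_I ConC_I_dom (\<lambda>A. A)"
  obtain H K DH DK where "reduction_to_choice (\<lambda>p A. neg_rep UNIV p A \<and> A \<in> PC_dom UNIV)
      {0..1} ConC_I_dom H K DH DK"
    by (rule weihrauch_le_choice_reduction[OF le]) (auto simp: ConC_I_dom_def cauchy_I_def)
  then interpret reduction_to_choice "\<lambda>p A. neg_rep UNIV p A \<and> A \<in> PC_dom UNIV"
      "{0..1}" ConC_I_dom H K DH DK .
  \<comment> \<open>The code of the empty interval serves as "no information yet". From position t
    on, \<open>P t\<close> lists intervals (-i,t), which exhaust the half-line below t.\<close>
  define p :: baire where "p = (\<lambda>_. interval_code 0 0)"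
  define P :: "nat \<Rightarrow> baire"
    where "P t i = (if i < t then interval_code 0 0 else interval_code (- real i) (real t))" for t i
  have p: "neg_rep UNIV p UNIV \<and> UNIV \<in> PC_dom UNIV"
    by (simp add: neg_rep_def p_def PC_dom_def)
  have "(\<Union>i. rat_interval (P t i)) = {..<real t}" for t
  proof (intro equalityI subsetI)
    fix x assume "x \<in> {..<real t}"
    moreover obtain i :: nat where "- x < i"
      using reals_Archimedean2 by blast
    ultimately have "x \<in> rat_interval (P t (max t i))"
      by (auto simp: P_def)
    then show "x \<in> (\<Union>i. rat_interval (P t i))"
      by blast
  qed (auto simp: P_def split: if_splits)
  then have P: "neg_rep UNIV (P t) {real t..} \<and> {real t..} \<in> PC_dom UNIV" for t
    using less_le_trans[OF zero_less_one, of "emeasure lborel {real t..}"]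
      emeasure_mono[of "{real t..real t + 1}" "{real t..}" lborel]
    by (auto simp: neg_rep_def PC_dom_def)
  have lim: "P \<longlonglongrightarrow> p"
    by (rule baire_tendsto_eq_below) (simp add: P_def p_def)
  have "\<exists>y. y \<in> coded_set {0..1} (K (P t))" for t
    using instance_K[OF P] by (fastforce simp: ConC_I_dom_def)
  then obtain y where y: "\<And>t. y t \<in> coded_set {0..1} (K (P t))"
    by metis
  have bounded: "\<bar>y t\<bar> \<le> 1" for t
    using y[of t] by (auto simp: coded_set_def)
  obtain R s w where s: "strict_mono s" and R: "\<And>t. cauchy_R (R t) (y t)"
    and lim_H: "\<forall>Q. Q \<longlonglongrightarrow> p \<longrightarrow> (\<forall>t. (\<exists>A. neg_rep UNIV (Q t) A \<and> A \<in> PC_dom UNIV)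
        \<and> y t \<in> coded_set {0..1} (K (Q t))) \<longrightarrow> (\<lambda>t. H (pairB (Q (s t)) (R (s t)))) \<longlonglongrightarrow> w"
    by (rule accumulating_solutions[OF lim P p y bounded]) blast
  have w: "(\<lambda>t. H (pairB (P (s t)) (R (s t)))) \<longlonglongrightarrow> w"
    using lim_H[rule_format, OF lim] P y by blast
  \<comment> \<open>Entry 0 of a Cauchy name has error at most 1, so the fixed value
    \<open>w 0\<close> would bound all t.\<close>
  have "\<forall>\<^sub>F t in sequentially. H (pairB (P (s t)) (R (s t))) 0 = w 0"
    using w by (simp add: baire_tendsto_iff)
  then have "\<forall>\<^sub>F t in sequentially. real t \<le> nu_rat (w 0) + 1"
  proof eventually_elim
    case (elim t)
    obtain z where "z \<ge> real (s t)" "cauchy_R (H (pairB (P (s t)) (R (s t)))) z"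
      using solution_H[OF P y R] by auto
    moreover have "t \<le> s t"
      using s by (rule seq_suble)
    ultimately show ?case
      using elim by (smt (verit) cauchy_R_def of_nat_mono power_0)
  qed
  moreover obtain N where "nu_rat (w 0) + 1 < real N"
    using reals_Archimedean2 by blast
  ultimately show False
    by (smt (verit) eventually_sequentially linorder_le_cases of_nat_mono)
qed

section \<open>Connected choice is not reducible to positive choice\<close>

text \<open>Every point \<open>q\<close> of Baire space determines a nested sequence of intervals: if \<open>q n\<close> encodes
  \<open>(u, v)\<close>, the \<open>n\<close>-th interval is divided into \<open>Suc v\<close> equal parts, and the part number \<open>min u v\<close>
  is the next interval. In particular, \<open>q n = 0\<close> leaves the interval unchanged.\<close>

definition parts :: "nat \<Rightarrow> nat" where
  "parts m = Suc (snd (prod_decode m))"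

definition part_index :: "nat \<Rightarrow> nat" where
  "part_index m = min (fst (prod_decode m)) (snd (prod_decode m))"

primrec width :: "baire \<Rightarrow> nat \<Rightarrow> real" where
  "width q 0 = 1"
| "width q (Suc n) = width q n / real (parts (q n))"

primrec left_end :: "baire \<Rightarrow> nat \<Rightarrow> real" where
  "left_end q 0 = 0"
| "left_end q (Suc n) = left_end q n + real (part_index (q n)) * width q (Suc n)"

definition nested_intersection :: "baire \<Rightarrow> real set" where
  "nested_intersection q = (\<Inter>n. {left_end q n..left_end q n + width q n})"

text \<open>Even entries remove what lies left of an interval, odd entries what lies right of it.
  The outer bounds -1 and 2 lie outside [0,1], so that the points 0 and 1 can be removed too. Entry
  i depends on q only below \<open>i div 2\<close>, whence continuity.\<close>

definition nested_name :: "baire \<Rightarrow> baire" where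
  "nested_name q i = (if even i then interval_code (-1) (left_end q (i div 2))
     else interval_code (left_end q (i div 2) + width q (i div 2)) 2)"

lemma parts_0 [simp]: "parts 0 = 1" and part_index_0 [simp]: "part_index 0 = 0"
  by (simp_all add: parts_def part_index_def prod_decode_def prod_decode_aux.simps)

lemma width_pos: "0 < width q n"
  by (induction n) (simp_all add: parts_def)

lemma width_left_end_cong:
  assumes "\<And>i. i < n \<Longrightarrow> q i = q' i"
  shows "width q n = width q' n \<and> left_end q n = left_end q' n"
  using assms by (induction n) auto

lemma width_left_end_Rats: "width q n \<in> \<rat> \<and> left_end q n \<in> \<rat>"
  by (induction n) auto

lemma left_end_incseq: "incseq (left_end q)"
  by (rule incseq_SucI) (simp add: width_pos less_imp_le)

lemma right_end_decseq: "decseq (\<lambda>n. left_end q n + width q n)"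
proof (rule decseq_SucI)
  fix n
  have "left_end q (Suc n) + width q (Suc n)
      = left_end q n + real (Suc (part_index (q n))) * width q (Suc n)"
    by (simp add: algebra_simps add_divide_distrib)
  also have "\<dots> \<le> left_end q n + real (parts (q n)) * width q (Suc n)"
    using width_pos[of q "Suc n"]
    by (intro add_left_mono mult_right_mono) (simp_all add: parts_def part_index_def)
  also have "\<dots> = left_end q n + width q n"
    by (simp add: parts_def)
  finally show "left_end q (Suc n) + width q (Suc n) \<le> left_end q n + width q n" .
qed

text \<open>Comparison at stage \<open>max m n\<close> puts every left end below every right end, so
  the intersection runs from the supremum of the former to the infimum of the latter.\<close>

lemma nested_intersection_ConC: "nested_intersection q \<in> ConC_I_dom"
proof -
  define a where "a = (SUP n. left_end q n)"
  define b where "b = (INF n. left_end q n + width q n)"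
  have le: "left_end q m \<le> left_end q n + width q n" for m n
  proof -
    have "left_end q m \<le> left_end q (max m n)"
      using left_end_incseq by (simp add: incseq_def)
    also have "\<dots> \<le> left_end q (max m n) + width q (max m n)"
      using width_pos[of q "max m n"] by simp
    also have "\<dots> \<le> left_end q n + width q n"
      using right_end_decseq[of q] by (simp add: decseq_def)
    finally show ?thesis .
  qed
  have bdd: "bdd_above (range (left_end q))" "bdd_below (range (\<lambda>n. left_end q n + width q n))"
    using le by (auto simp: bdd_above_def bdd_below_def)
  have "nested_intersection q = {a..b}"
    unfolding nested_intersection_def a_def b_def
    using cSUP_le_iff[OF _ bdd(1)] le_cINF_iff[OF _ bdd(2)] by auto
  moreover have "0 \<le> a"
    unfolding a_def using cSUP_upper[OF _ bdd(1), of 0] by simp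
  moreover have "b \<le> 1"
    unfolding b_def using cINF_lower[OF bdd(2), of 0] by simp
  moreover have "a \<le> b"
    unfolding a_def b_def by (intro cSUP_least cINF_greatest) (auto simp: le)
  ultimately show ?thesis
    unfolding ConC_I_dom_def by blast
qed

lemma neg_rep_nested_name: "neg_rep {0..1} (nested_name q) (nested_intersection q)"
  unfolding neg_rep_def
proof (intro conjI equalityI subsetI)
  show "x \<in> {0..1}" if "x \<in> nested_intersection q" for x
    using that unfolding nested_intersection_def
    by (metis INT_iff UNIV_I add_0 left_end.simps(1) width.simps(1))
  have even: "rat_interval (nested_name q (2 * n)) = {-1<..<left_end q n}" for n
    by (simp add: nested_name_def width_left_end_Rats)
  have odd: "rat_interval (nested_name q (Suc (2 * n))) = {left_end q n + width q n<..<2}" for n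
    by (simp add: nested_name_def width_left_end_Rats)
  fix x
  show "x \<in> {0..1} - nested_intersection q" if x: "x \<in> (\<Union>i. rat_interval (nested_name q i)) \<inter> {0..1}"
  proof -
    obtain i where i: "x \<in> rat_interval (nested_name q i)"
      using x by blast
    have "x < left_end q (i div 2) \<or> left_end q (i div 2) + width q (i div 2) < x"
    proof (cases "even i")
      case True
      then show ?thesis using i even[of "i div 2"] by auto
    next
      case False
      then show ?thesis using i odd[of "i div 2"] by auto
    qed
    then have "x \<notin> {left_end q (i div 2)..left_end q (i div 2) + width q (i div 2)}"
      by auto
    then show ?thesis
      using x unfolding nested_intersection_def by blast
  qed
  show "x \<in> (\<Union>i. rat_interval (nested_name q i)) \<inter> {0..1}" if x: "x \<in> {0..1} - nested_intersection q"
  proof -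
    obtain n where "x \<notin> {left_end q n..left_end q n + width q n}"
      using x unfolding nested_intersection_def by blast
    then have "x < left_end q n \<or> left_end q n + width q n < x"
      by auto
    then have "x \<in> rat_interval (nested_name q (2 * n)) \<or> x \<in> rat_interval (nested_name q (Suc (2 * n)))"
      using x unfolding even odd by auto
    then show ?thesis
      using x by blast
  qed
qed

lemma continuous_nested_name: "continuous_on UNIV nested_name"
  unfolding continuous_on_def baire_tendsto_iff
proof (intro ballI allI)
  fix q :: baire and i :: nat
  have "\<forall>\<^sub>F q' in at q. \<forall>j<i div 2. q' j = q j"
    by (rule baire_tendsto_prefix) (rule tendsto_ident_at)
  then show "\<forall>\<^sub>F q' in at q. nested_name q' i = nested_name q i"
  proof eventually_elim
    case (elim q')
    then show ?case
      using width_left_end_cong[of "i div 2" q' q] by (simp add: nested_name_def)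
  qed
qed

lemma left_end_width_constant:
  assumes "\<And>i. m \<le> i \<Longrightarrow> q i = 0" and "m \<le> t"
  shows "left_end q t = left_end q m \<and> width q t = width q m"
  using assms(2) by (induction t rule: dec_induct) (simp_all add: assms(1))

text \<open>Zero entries keep the interval of stage m unchanged, so the entry at t divides that same
  interval. The bounds do not involve t: the selection of a part can be postponed at will.\<close>

lemma nested_intersection_part:
  assumes zero: "\<And>i. m \<le> i \<Longrightarrow> q i = 0" and "m \<le> t" and "i \<le> v"
    and z: "z \<in> nested_intersection (q(t := prod_encode (i, v)))"
  shows "left_end q m + i * (width q m / Suc v) \<le> z"
    and "z \<le> left_end q m + Suc i * (width q m / Suc v)"
proof -
  let ?q = "q(t := prod_encode (i, v))"
  have "width ?q t = width q m \<and> left_end ?q t = left_end q m"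
    using width_left_end_cong[of t ?q q] left_end_width_constant[of m q t] assms by simp
  then have "width ?q (Suc t) = width q m / Suc v"
      "left_end ?q (Suc t) = left_end q m + i * (width q m / Suc v)"
    using \<open>i \<le> v\<close> by (simp_all add: parts_def part_index_def min_absorb1)
  moreover have "z \<in> {left_end ?q (Suc t)..left_end ?q (Suc t) + width ?q (Suc t)}"
    using z unfolding nested_intersection_def by blast
  ultimately show "left_end q m + i * (width q m / Suc v) \<le> z"
      "z \<le> left_end q m + Suc i * (width q m / Suc v)"
    by (simp_all only: atLeastAtMost_iff of_nat_Suc distrib_right mult_1 ac_simps)
qed

section \<open>Baire category, pigeonhole and the contradiction\<close>

lemma measure_pigeonhole:
  fixes e :: real
  assumes "finite S" and A: "\<And>i. i \<in> S \<Longrightarrow> A i \<in> sets M" "\<And>i. i \<in> S \<Longrightarrow> A i \<subseteq> B"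
    and B: "B \<in> fmeasurable M" and e: "\<And>i. i \<in> S \<Longrightarrow> e \<le> measure M (A i)"
    and large: "measure M B < card S * e"
  obtains i j where "i \<in> S" "j \<in> S" "i \<noteq> j" "A i \<inter> A j \<noteq> {}"
proof (rule ccontr)
  assume "\<not> thesis"
  then have disj: "disjoint_family_on A S"
    using that unfolding disjoint_family_on_def by blast
  have fin: "emeasure M (A i) \<noteq> \<infinity>" if "i \<in> S" for i
    using A B that by (metis emeasure_mono fmeasurable_def infinity_ennreal_def leD
        mem_Collect_eq top.not_eq_extremum fmeasurableD)
  have "card S * e \<le> (\<Sum>i\<in>S. measure M (A i))"
    using e sum_mono[of S "\<lambda>_. e" "\<lambda>i. measure M (A i)"] by simp
  also have "\<dots> = measure M (\<Union>i\<in>S. A i)"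
    by (rule measure_finite_Union[OF \<open>finite S\<close> _ disj fin, symmetric]) (use A(1) in auto)
  also have "\<dots> \<le> measure M B"
    using A \<open>finite S\<close> B by (intro measure_mono_fmeasurable) auto
  finally show False
    using large by simp
qed

text \<open>By the Baire category theorem there are a finite prefix and an \<open>N\<close> such that all nested
  sequences of intervals with that prefix are sent to sets with a part of measure at least
  \<open>1 / Suc N\<close> in \<open>{-N..N}\<close>. After the prefix there is still room for more than \<open>2 * N * Suc N\<close>
  separated subintervals, so two of the corresponding sets must share a solution \<open>y\<close>. If the
  subintervals are chosen late enough, \<open>H\<close> cannot tell them apart, but it has to map \<open>y\<close> into
  both.\<close>

lemma ConC_not_reducible_to_PC:
  assumes "reduction_to_choice (\<lambda>p A. neg_rep {0..1} p A \<and> A \<in> ConC_I_dom) X (PC_dom X) H K DH DK"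
  shows False
proof -
  from assms interpret reduction_to_choice "\<lambda>p A. neg_rep {0..1} p A \<and> A \<in> ConC_I_dom"
    X "PC_dom X" H K DH DK .
  define M where "M q = coded_set X (K (nested_name q))" for q
  have name: "neg_rep {0..1} (nested_name q) (nested_intersection q)
      \<and> nested_intersection q \<in> ConC_I_dom" for q
    using neg_rep_nested_name nested_intersection_ConC by blast
  define C where "C N = {q. 1 / real (Suc N) \<le> measure lborel (M q \<inter> {- real N..real N})}" for N
  have closed_C: "closed (C N)" for N
  proof -
    have "continuous_on UNIV (\<lambda>q. K (nested_name q))"
      using continuous_on_compose2[OF continuous_K continuous_nested_name] in_DK[OF name] by blast
    from closed_vimage[OF closed_measure_coded_set_ge[OF closed_space] this]
    show ?thesis
      by (simp add: C_def M_def vimage_def)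
  qed
  have "\<exists>N. q \<in> C N" for q
  proof -
    have "closed (M q)" "0 < emeasure lebesgue (M q)"
      using instance_K[OF name, of q] unfolding M_def PC_dom_def by blast+
    then show ?thesis
      by (rule positive_measure_in_bounded_part) (auto simp: C_def)
  qed
  then have cover: "\<Union> (range C) = UNIV"
    by blast
  have "\<exists>N. interior (C N) \<noteq> {}"
  proof (rule ccontr)
    assume "\<not> (\<exists>N. interior (C N) \<noteq> {})"
    then have "euclidean interior_of \<Union> (range C) = {}"
      using closed_C by (intro Baire_category_alt) (auto simp: completely_metrizable_baire)
    then show False
      by (simp add: cover)
  qed
  then obtain N q1 where q1: "q1 \<in> interior (C N)"
    by blast
  have inside: "\<forall>\<^sub>F t in sequentially. Q t \<in> interior (C N)"
    if "Q \<longlonglongrightarrow> q" "q \<in> interior (C N)" for Q q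
    using that topological_tendstoD by blast
  \<comment> \<open>Truncating \<open>q1\<close> by zeros replaces it by an eventually zero point of
    the same open set, as \<open>nested_intersection_part\<close> requires.\<close>
  have "(\<lambda>t i. if i < t then q1 i else 0) \<longlonglongrightarrow> q1"
    by (rule baire_tendsto_eq_below) simp
  from eventually_happens'[OF sequentially_bot inside[OF this q1]]
  obtain m where m: "(\<lambda>i. if i < m then q1 i else 0) \<in> interior (C N)"
    by blast
  define q0 where "q0 i = (if i < m then q1 i else 0)" for i
  have q0: "q0 \<in> interior (C N)" and zero: "\<And>i. m \<le> i \<Longrightarrow> q0 i = 0"
    using m by (simp_all add: q0_def[abs_def])

  \<comment> \<open>With this k, sets of measure at least 1/(N+1) for k indices exceed 2N, the
    length of [-N,N], in total. There are \<open>Suc v\<close> = 2k parts, of which only the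
    even-numbered ones are used, leaving gaps of a full part between them.\<close>
  obtain k where k: "2 * real N * real (Suc N) < real k"
    using reals_Archimedean2 by blast
  define v where "v = 2 * k - 1"
  define Q where "Q t i = q0(t := prod_encode (2 * i, v))" for t i
  have Q_lim: "(\<lambda>t. Q (t + T) (I t)) \<longlonglongrightarrow> q0" for T I
    by (rule baire_tendsto_eq_below) (simp add: Q_def)
  have "\<forall>\<^sub>F t in sequentially. \<forall>i\<in>{..<k}. Q t i \<in> interior (C N)"
    by (rule eventually_ball_finite) (use inside[OF Q_lim[of 0] q0] in auto)
  then obtain T0 where T0: "\<And>t i. t \<ge> T0 \<Longrightarrow> i < k \<Longrightarrow> Q t i \<in> C N"
    using interior_subset[of "C N"] unfolding eventually_sequentially by blast
  \<comment> \<open>Late enough both for the points \<open>Q\<close> to lie in \<open>C N\<close>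
    and for the selection to come after the prefix.\<close>
  define T where "T = max T0 m"
  have "\<exists>i j y. i < k \<and> j < k \<and> i \<noteq> j \<and> y \<in> M (Q (t + T) i) \<and> y \<in> M (Q (t + T) j) \<and> \<bar>y\<bar> \<le> N" for t
  proof -
    let ?A = "\<lambda>i. M (Q (t + T) i) \<inter> {- real N..real N}"
    obtain i j where "i \<in> {..<k}" "j \<in> {..<k}" "i \<noteq> j" "?A i \<inter> ?A j \<noteq> {}"
    proof (rule measure_pigeonhole)
      show "finite {..<k}" by simp
      show "?A i \<in> sets lborel" for i
        using closed_coded_set[OF closed_space] by (simp add: M_def borel_closed)
      show "{- real N..real N} \<in> fmeasurable lborel"
        by (auto simp: fmeasurable_def)
      show "1 / real (Suc N) \<le> measure lborel (?A i)" if "i \<in> {..<k}" for i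
        using T0[of "t + T" i] that by (simp add: C_def T_def)
      show "measure lborel {- real N..real N} < real (card {..<k}) * (1 / real (Suc N))"
        using k by (simp add: pos_less_divide_eq)
    qed auto
    then show ?thesis
      by (auto simp: abs_le_iff minus_le_iff) blast
  qed
  then obtain I J y where IJ: "\<And>t. I t < k" "\<And>t. J t < k" "\<And>t. I t \<noteq> J t"
    and y: "\<And>t. y t \<in> M (Q (t + T) (I t))" "\<And>t. y t \<in> M (Q (t + T) (J t))"
    and bounded: "\<And>t. \<bar>y t\<bar> \<le> N"
    by metis
  let ?P = "\<lambda>I t. nested_name (Q (t + T) (I t))"
  have P: "?P I \<longlonglongrightarrow> nested_name q0" for I
    using continuous_on_tendsto_compose[OF continuous_nested_name Q_lim] by simp
  note y' = y[unfolded M_def]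
  obtain R s w where R: "\<And>t. cauchy_R (R t) (y t)"
    and lim_H: "\<forall>Q. Q \<longlonglongrightarrow> nested_name q0 \<longrightarrow> (\<forall>t. (\<exists>A. neg_rep {0..1} (Q t) A \<and> A \<in> ConC_I_dom)
        \<and> y t \<in> coded_set X (K (Q t))) \<longrightarrow> (\<lambda>t. H (pairB (Q (s t)) (R (s t)))) \<longlonglongrightarrow> w"
    by (rule accumulating_solutions[OF P name name y'(1) bounded]) blast
  have w: "(\<lambda>t. H (pairB (?P I (s t)) (R (s t)))) \<longlonglongrightarrow> w"
      "(\<lambda>t. H (pairB (?P J (s t)) (R (s t)))) \<longlonglongrightarrow> w"
    using lim_H[rule_format, OF P] name y' by blast+
  \<comment> \<open>The length of one part. Two results within e/2 of the common value
    \<open>w n\<close> differ by less than e, whereas distinct even-numbered parts are at least e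
    apart.\<close>
  define e where "e = width q0 m / Suc v"
  have e: "0 < e"
    using width_pos by (simp add: e_def)
  obtain n where n: "(1/2) ^ n < e / 2"
    using real_arch_pow_inv[of "e/2" "1/2"] e by auto
  have "\<forall>\<^sub>F t in sequentially. H (pairB (?P I (s t)) (R (s t))) n = w n
      \<and> H (pairB (?P J (s t)) (R (s t))) n = w n"
    using w by (simp add: baire_tendsto_iff eventually_conj)
  then obtain t where t: "H (pairB (?P I (s t)) (R (s t))) n = w n"
      "H (pairB (?P J (s t)) (R (s t))) n = w n"
    using eventually_happens'[OF sequentially_bot] by blast
  have near: "\<exists>z. left_end q0 m + real (2 * l) * e \<le> z
      \<and> z \<le> left_end q0 m + real (Suc (2 * l)) * e \<and> \<bar>nu_rat (w n) - z\<bar> < e / 2"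
    if l: "l < k" and yl: "y (s t) \<in> coded_set X (K (nested_name (Q (s t + T) l)))"
      and Hw: "H (pairB (nested_name (Q (s t + T) l)) (R (s t))) n = w n" for l
  proof -
    obtain z where z: "z \<in> nested_intersection (Q (s t + T) l)"
      "cauchy_R (H (pairB (nested_name (Q (s t + T) l)) (R (s t)))) z"
      using solution_H[OF name yl R] by blast
    have "2 * l \<le> v" "m \<le> s t + T"
      using l by (simp_all add: v_def T_def)
    from nested_intersection_part[OF zero this(2,1) z(1)[unfolded Q_def]]
    have "left_end q0 m + real (2 * l) * e \<le> z"
      "z \<le> left_end q0 m + real (Suc (2 * l)) * e"
      by (simp_all add: e_def)
    moreover have "\<bar>nu_rat (w n) - z\<bar> < e / 2"
      using z(2) Hw n unfolding cauchy_R_def by (metis order_le_less_trans)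
    ultimately show ?thesis
      by blast
  qed
  have separated: False
    if "i < j" "z \<le> left_end q0 m + real (Suc (2 * i)) * e" "left_end q0 m + real (2 * j) * e \<le> z'"
      "\<bar>nu_rat (w n) - z\<bar> < e / 2" "\<bar>nu_rat (w n) - z'\<bar> < e / 2" for i j z z'
  proof -
    have "real (Suc (Suc (2 * i))) * e \<le> real (2 * j) * e"
      using that(1) e by (intro mult_right_mono) auto
    then have "real (Suc (2 * i)) * e + e \<le> real (2 * j) * e"
      by (simp add: algebra_simps)
    then show False
      using that(2-5) by linarith
  qed
  obtain z where z: "left_end q0 m + real (2 * I (s t)) * e \<le> z"
    "z \<le> left_end q0 m + real (Suc (2 * I (s t))) * e" "\<bar>nu_rat (w n) - z\<bar> < e / 2"
    using near[OF IJ(1) y'(1) t(1)] by blast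
  obtain z' where z': "left_end q0 m + real (2 * J (s t)) * e \<le> z'"
    "z' \<le> left_end q0 m + real (Suc (2 * J (s t))) * e" "\<bar>nu_rat (w n) - z'\<bar> < e / 2"
    using near[OF IJ(2) y'(2) t(2)] by blast
  show False
    using IJ(3)[of "s t"] separated[OF _ z(2) z'(1) z(3) z'(3)] separated[OF _ z'(2) z(1) z'(3) z(3)]
    by (metis linorder_neqE_nat)
qed

text \<open>Keeping \<open>X\<close> and \<open>repX\<close> general lets one argument cover
  positive choice on the line and on [0,1].\<close>

lemma ConC_not_le_PC:
  assumes "closed X"
    and repX: "\<And>r y. y \<in> X \<Longrightarrow> cauchy_R r y \<Longrightarrow> repX r y"
  shows "\<not> weihrauch_le (neg_rep {0..1}) cauchy_I ConC_I_dom (\<lambda>A. A)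
                        (neg_rep X) repX (PC_dom X) (\<lambda>A. A)"
proof
  assume le: "weihrauch_le (neg_rep {0..1}) cauchy_I ConC_I_dom (\<lambda>A. A)
                           (neg_rep X) repX (PC_dom X) (\<lambda>A. A)"
  show False
    by (rule weihrauch_le_choice_reduction[OF le \<open>closed X\<close>])
      (auto simp: PC_dom_def cauchy_I_def repX intro: ConC_not_reducible_to_PC)
qed

theorem theorem15p4:
  shows "\<not> weihrauch_le (neg_rep {0..1}) cauchy_I ConC_I_dom (\<lambda>A. A)
                        (neg_rep UNIV) cauchy_R (PC_dom UNIV) (\<lambda>A. A)
       \<and> \<not> weihrauch_le (neg_rep UNIV) cauchy_R (PC_dom UNIV) (\<lambda>A. A)
                        (neg_rep {0..1}) cauchy_I ConC_I_dom (\<lambda>A. A)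
       \<and> \<not> weihrauch_le (neg_rep {0..1}) cauchy_I ConC_I_dom (\<lambda>A. A)
                        (neg_rep {0..1}) cauchy_I (PC_dom {0..1}) (\<lambda>A. A)"
  using ConC_not_le_PC[of UNIV cauchy_R] ConC_not_le_PC[of "{0..1}" cauchy_I] PC_not_le_ConC
  by (simp add: cauchy_I_def)

end
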